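(* The generating function $R(x)=\sum_{n\geq 0}|I_n(000,021)|\,x^{n+1}$ is given by $$R(x)=\frac{3x^3+x^2-3x+1}{2x^2\sqrt{(1+x)(1-3x)}}-\frac{(1-x)^2}{2x^2}=x+2x^2+5x^3+14x^4+39x^5+111x^6+317x^7+911x^8+2627x^9+7600x^{10}+\cdots.$$ Moreover, for all $n\geq 1$, $$|I_{n-1}(000,021)|=\frac12\left(3a_{n-1}+a_n-3a_{n+1}+a_{n+2}\right),$$ where $a_n=\sum_{k=0}^n(-1)^{n-k}\binom{n}{k}\binom{2k}{k}$.
   Context: For $n\ge 0$, $I_n$ denotes the set of inversion sequences $e=e_0e_1\cdots e_n$, i.e. integer sequences with $0\le e_i\le i$ for each $0\le i\le n$ (so elements of $I_n$ have $n+1$ letters). An inversion sequence contains a pattern (word) $\tau$ of length $k$ if it has a subsequence (not necessarily consecutive) of length $k$ that is order isomorphic to $\tau$ (same relative order, including equalities); otherwise it avoids $\tau$. $I_n(\tau_1,\dots,\tau_m)$ is the set of $e\in I_n$ avoiding all of $\tau_1,\dots,\tau_m$. Generating functions are formal power series in $x$ (the right-hand side is expanded as a Laurent series at $x=0$, with $\sqrt{\cdot}$ having constant term $1$). *)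

theory Defs
  imports Complex_Main "HOL-Library.Sublist" "HOL-Computational_Algebra.Formal_Laurent_Series"
begin

(* Words are lists of naturals; the letter e_i is e ! i, so elements of inv_seqs n have n + 1 letters. *)
definition inv_seqs :: "nat \<Rightarrow> nat list set" where
  "inv_seqs n = {e. length e = n + 1 \<and> (\<forall>i\<le>n. e ! i \<le> i)}"

definition order_isomorphic :: "nat list \<Rightarrow> nat list \<Rightarrow> bool" where
  "order_isomorphic u v \<longleftrightarrow> length u = length v \<and>
     (\<forall>i<length u. \<forall>j<length u.
        (u ! i < u ! j \<longleftrightarrow> v ! i < v ! j) \<and> (u ! i = u ! j \<longleftrightarrow> v ! i = v ! j))"

definition contains_pattern :: "nat list \<Rightarrow> nat list \<Rightarrow> bool" where
  "contains_pattern e \<tau> \<longleftrightarrow> (\<exists>u. subseq u e \<and> order_isomorphic u \<tau>)"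

definition inv_seqs_avoiding :: "nat \<Rightarrow> nat list set \<Rightarrow> nat list set" where
  "inv_seqs_avoiding n T = {e \<in> inv_seqs n. \<forall>\<tau>\<in>T. \<not> contains_pattern e \<tau>}"

definition R_000_021 :: "real fps" where
  "R_000_021 = fps_X * Abs_fps (\<lambda>n. real (card (inv_seqs_avoiding n {[0,0,0], [0,2,1]})))"

(* The square root whose constant term is the nonnegative real root of the constant term of f. *)
definition fps_sqrt :: "real fps \<Rightarrow> real fps" where
  "fps_sqrt f = fps_radical root 2 f"

definition a_seq :: "nat \<Rightarrow> int" where
  "a_seq n = (\<Sum>k=0..n. (-1) ^ (n - k) * int (n choose k) * int ((2 * k) choose k))"

end

theory Submission
  imports Defs
begin

text \<open>Since an inversion sequence starts with \<open>0\<close>, it avoids \<open>021\<close> if and only if its nonzero letters are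
  weakly increasing, and it avoids \<open>000\<close> if and only if no letter occurs three times.  So the sequences to be
  counted consist of a leading \<open>0\<close>, at most one further \<open>0\<close>, and weakly increasing positive letters, each used
  at most twice, with \<open>e_i \<le> i\<close>.

  Such words are read from left to right.  All that matters for the number of ways to continue is how far the
  bound on the next letter exceeds the current maximum (the slack \<open>s\<close>), and whether a copy of the maximum and a
  zero are still available; this yields a recursion on the length (\<open>Cons_mem_conts_iff\<close>, \<open>card_conts\<close>).

  Let \<open>M = 1 + xM + x\<^sup>2M\<^sup>2\<close> be the generating function of the Motzkin numbers, and let
  \<open>A = 1 / (1 - x - 2x\<^sup>2M) = 1 / \<surd>((1 + x)(1 - 3x))\<close>.  The recursion is solved in closed form: with neither a zero
  nor a copy of the maximum available, the continuations of slack \<open>s\<close> have generating function \<open>M^s\<close>; if a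
  zero is available, it is \<open>M^s + x (1 + s (A - 1)) M^(s+1)\<close>; the other two cases reduce to these
  (\<open>cont_fps_rec\<close>, \<open>cont_count_eq_nth\<close>).  For \<open>s = 1\<close> this gives \<open>R = x (M + x A M\<^sup>2)\<close>, and elimination of \<open>M\<close>
  turns it into \<open>2x\<^sup>2 R = (3x\<^sup>3 + x\<^sup>2 - 3x + 1) A - (1 - x)\<^sup>2\<close> (\<open>R_000_021_closed_form\<close>).  The coefficients of \<open>A\<close>
  are the numbers \<open>a_n\<close> (\<open>trinomial_fps_nth\<close>), so comparing coefficients gives the formula for the
  cardinalities of the sets.\<close>

section \<open>Pattern avoidance\<close>

lemma subseq_replicate_iff_count_list:
  "subseq (replicate k x) w \<longleftrightarrow> k \<le> count_list w x"
proof (induction w arbitrary: k)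
  case Nil
  then show ?case by (cases k) auto
next
  case (Cons y w)
  show ?case
  proof (cases k)
    case 0
    then show ?thesis by simp
  next
    case (Suc k')
    then show ?thesis using Cons.IH[of k'] Cons.IH[of k] by auto
  qed
qed

lemma sorted_filter_iff_subseq:
  fixes w :: "'a::linorder list"
  shows "sorted (filter P w) \<longleftrightarrow> (\<forall>b c. subseq [b, c] w \<longrightarrow> P b \<longrightarrow> P c \<longrightarrow> b \<le> c)"
proof (induction w)
  case (Cons y w)
  have "subseq [b, c] (y # w) \<longleftrightarrow> (b = y \<and> c \<in> set w) \<or> subseq [b, c] w" for b c
    by (auto simp: subseq_singleton_left dest: subseq_Cons')
  then show ?case using Cons.IH by auto
qed simp

lemma order_isomorphic_000: "order_isomorphic u [0, 0, 0] \<longleftrightarrow> (\<exists>x. u = replicate 3 x)"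
proof
  assume iso: "order_isomorphic u [0, 0, 0]"
  then have "length u = 3" by (simp add: order_isomorphic_def)
  then obtain a b c where u: "u = [a, b, c]"
    by (auto simp: length_Suc_conv numeral_3_eq_3)
  have "u ! 0 = u ! 1" "u ! 1 = u ! 2"
    using iso \<open>length u = 3\<close> by (auto simp: order_isomorphic_def)
  then show "\<exists>x. u = replicate 3 x" using u by (simp add: numeral_3_eq_3)
next
  assume "\<exists>x. u = replicate 3 x"
  then show "order_isomorphic u [0, 0, 0]"
    by (auto simp: order_isomorphic_def less_Suc_eq numeral_3_eq_3)
qed

lemma order_isomorphic_021:
  "order_isomorphic u [0, 2, 1] \<longleftrightarrow> (\<exists>a b c. u = [a, b, c] \<and> a < c \<and> c < b)"
proof
  assume iso: "order_isomorphic u [0, 2, 1]"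
  then have "length u = 3" by (simp add: order_isomorphic_def)
  then obtain a b c where u: "u = [a, b, c]"
    by (auto simp: length_Suc_conv numeral_3_eq_3)
  have "u ! 0 < u ! 2" "u ! 2 < u ! 1"
    using iso \<open>length u = 3\<close> by (auto simp: order_isomorphic_def)
  then show "\<exists>a b c. u = [a, b, c] \<and> a < c \<and> c < b" using u by simp
next
  assume "\<exists>a b c. u = [a, b, c] \<and> a < c \<and> c < b"
  then show "order_isomorphic u [0, 2, 1]"
    by (auto simp: order_isomorphic_def less_Suc_eq)
qed

lemma contains_000_iff: "contains_pattern e [0, 0, 0] \<longleftrightarrow> (\<exists>x. 3 \<le> count_list e x)"
  unfolding contains_pattern_def order_isomorphic_000 subseq_replicate_iff_count_list[symmetric]
  by blast

text \<open>The leading \<open>0\<close> can always play the smallest letter of the pattern, so that avoiding \<open>021\<close> only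
  constrains the nonzero letters.  Inversion sequences always start with \<open>0\<close>.\<close>

lemma contains_021_Cons_0_iff:
  "contains_pattern (0 # w) [0, 2, 1] \<longleftrightarrow> \<not> sorted (filter (\<lambda>x. x \<noteq> 0) w)"
proof -
  have "contains_pattern (0 # w) [0, 2, 1] \<longleftrightarrow>
      (\<exists>a b c. subseq [a, b, c] (0 # w) \<and> a < c \<and> c < b)"
    unfolding contains_pattern_def order_isomorphic_021 by blast
  also have "\<dots> \<longleftrightarrow> (\<exists>b c. subseq [b, c] w \<and> 0 < c \<and> c < b)"
  proof
    assume "\<exists>a b c. subseq [a, b, c] (0 # w) \<and> a < c \<and> c < b"
    then obtain a b c where "subseq [a, b, c] (0 # w)" "a < c" "c < b" by blast
    then show "\<exists>b c. subseq [b, c] w \<and> 0 < c \<and> c < b"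
      by (intro exI[of _ b] exI[of _ c]) (auto split: if_splits dest: subseq_Cons')
  next
    assume "\<exists>b c. subseq [b, c] w \<and> 0 < c \<and> c < b"
    then obtain b c where "subseq [b, c] w" "0 < c" "c < b" by blast
    then show "\<exists>a b c. subseq [a, b, c] (0 # w) \<and> a < c \<and> c < b"
      by (intro exI[of _ 0] exI[of _ b] exI[of _ c]) simp
  qed
  also have "\<dots> \<longleftrightarrow> (\<exists>b c. subseq [b, c] w \<and> b \<noteq> 0 \<and> c \<noteq> 0 \<and> \<not> b \<le> c)"
    by (intro ex_cong1) (auto simp: not_le)
  finally show ?thesis
    unfolding sorted_filter_iff_subseq by blast
qed

section \<open>Counting words letter by letter\<close>

text \<open>The admissible continuations of length \<open>m\<close> of a partially read word: \<open>v\<close> is the largest letter read so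
  far, \<open>c\<close> the number of further copies of \<open>v\<close> allowed, \<open>z\<close> the number of further zeros allowed, and
  \<open>v + s\<close> the upper bound on the next letter (which grows by one with every position).
  If \<open>v = 0\<close>, then no nonzero letter has been read; zeros are governed by \<open>z\<close> alone, and \<open>c\<close> plays no
  role.\<close>

definition conts :: "nat \<Rightarrow> nat \<Rightarrow> nat \<Rightarrow> nat \<Rightarrow> nat \<Rightarrow> nat list set" where
  "conts v s c z m = {w. length w = m \<and> sorted (filter (\<lambda>x. x \<noteq> 0) w) \<and>
     (\<forall>x\<in>set w. x \<noteq> 0 \<longrightarrow> v \<le> x) \<and>
     (\<forall>x. x \<noteq> 0 \<longrightarrow> count_list w x \<le> (if x = v then c else 2)) \<and>
     count_list w 0 \<le> z \<and> (\<forall>i<m. w ! i \<le> i + v + s)}"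

lemma inv_seqs_avoiding_eq_conts:
  "inv_seqs_avoiding n {[0,0,0], [0,2,1]} = (#) 0 ` conts 0 1 0 1 n"
proof -
  have *: "e \<in> inv_seqs_avoiding n {[0,0,0], [0,2,1]} \<longleftrightarrow> (\<exists>w. e = 0 # w \<and> w \<in> conts 0 1 0 1 n)" for e
  proof (cases "\<exists>w. e = 0 # w")
    case True
    then obtain w where e: "e = 0 # w" by blast
    have "e \<in> inv_seqs n \<longleftrightarrow> length w = n \<and> (\<forall>i<n. w ! i \<le> i + 1)"
      by (simp only: inv_seqs_def e mem_Collect_eq All_less_Suc2 less_Suc_eq_le[symmetric]) auto
    moreover have "\<not> contains_pattern e [0,0,0] \<longleftrightarrow>
        (\<forall>x. x \<noteq> 0 \<longrightarrow> count_list w x \<le> (if x = 0 then 0 else 2)) \<and> count_list w 0 \<le> 1"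
    proof -
      have "count_list e x < 3 \<longleftrightarrow> (if x = 0 then count_list w 0 \<le> 1 else count_list w x \<le> 2)" for x
        by (auto simp: e)
      then show ?thesis unfolding contains_000_iff not_ex not_le by auto
    qed
    moreover have "\<not> contains_pattern e [0,2,1] \<longleftrightarrow> sorted (filter (\<lambda>x. x \<noteq> 0) w)"
      unfolding e contains_021_Cons_0_iff by simp
    ultimately have "e \<in> inv_seqs_avoiding n {[0,0,0], [0,2,1]} \<longleftrightarrow> w \<in> conts 0 1 0 1 n"
      unfolding inv_seqs_avoiding_def conts_def by simp blast
    then show ?thesis by (simp add: e)
  next
    case False
    then have "e \<notin> inv_seqs n"
      by (cases e) (auto simp: inv_seqs_def)
    then show ?thesis using False by (auto simp: inv_seqs_avoiding_def)
  qed
  then show ?thesis by (auto simp: image_def)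
qed

lemma conts_0: "conts v s c z 0 = {[]}"
  by (auto simp: conts_def)

text \<open>The first letter of a continuation is a zero, a further copy of \<open>v\<close>, or a new maximum \<open>y\<close>.  In the last
  case one more copy of \<open>y\<close> is allowed.  The hypothesis keeps the first two cases apart.\<close>

lemma Cons_mem_conts_iff:
  assumes "0 < v \<or> c = 0"
  shows "y # w \<in> conts v s c z (Suc m) \<longleftrightarrow>
    (y = 0 \<and> 0 < z \<and> w \<in> conts v (s + 1) c (z - 1) m) \<or>
    (y = v \<and> 0 < c \<and> w \<in> conts v (s + 1) (c - 1) z m) \<or>
    (v < y \<and> y \<le> v + s \<and> w \<in> conts y (v + s + 1 - y) 1 z m)"
proof -
  have b: "(\<forall>i<Suc m. (y # w) ! i \<le> i + v + s) \<longleftrightarrow> y \<le> v + s \<and> (\<forall>i<m. w ! i \<le> i + v + (s + 1))"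
    by (auto simp: All_less_Suc2)
  consider (zero) "y = 0" | (less) "0 < y" "y < v" | (eq) "0 < y" "y = v" | (gr) "v < y"
    by linarith
  then show ?thesis
  proof cases
    case zero
    have nonzeros: "sorted (filter (\<lambda>x. x \<noteq> 0) (y # w)) \<longleftrightarrow> sorted (filter (\<lambda>x. x \<noteq> 0) w)"
      "(\<forall>x\<in>set (y # w). x \<noteq> 0 \<longrightarrow> v \<le> x) \<longleftrightarrow> (\<forall>x\<in>set w. x \<noteq> 0 \<longrightarrow> v \<le> x)"
      "(\<forall>x. x \<noteq> 0 \<longrightarrow> count_list (y # w) x \<le> (if x = v then c else 2)) \<longleftrightarrow>
        (\<forall>x. x \<noteq> 0 \<longrightarrow> count_list w x \<le> (if x = v then c else 2))"
      using zero by simp_all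
    have zeros: "count_list (y # w) 0 \<le> z \<longleftrightarrow> 0 < z \<and> count_list w 0 \<le> z - 1"
      using zero by (cases z) auto
    have "y \<le> v + s" using zero by simp
    then have "y # w \<in> conts v s c z (Suc m) \<longleftrightarrow> 0 < z \<and> w \<in> conts v (s + 1) c (z - 1) m"
      unfolding conts_def mem_Collect_eq b nonzeros zeros length_Cons nat.inject by blast
    then show ?thesis using zero assms by auto
  next
    case less
    then have "y # w \<notin> conts v s c z (Suc m)" by (simp add: conts_def)
    then show ?thesis using less by simp
  next
    case eq
    have nonzeros: "sorted (filter (\<lambda>x. x \<noteq> 0) (y # w)) \<and> (\<forall>x\<in>set (y # w). x \<noteq> 0 \<longrightarrow> v \<le> x) \<longleftrightarrow>
        sorted (filter (\<lambda>x. x \<noteq> 0) w) \<and> (\<forall>x\<in>set w. x \<noteq> 0 \<longrightarrow> v \<le> x)"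
      using eq by auto
    have mult: "(\<forall>x. x \<noteq> 0 \<longrightarrow> count_list (y # w) x \<le> (if x = v then c else 2)) \<longleftrightarrow>
      0 < c \<and> (\<forall>x. x \<noteq> 0 \<longrightarrow> count_list w x \<le> (if x = v then c - 1 else 2))"
      using eq by (auto split: if_splits)
    have zeros: "count_list (y # w) 0 = count_list w 0" using eq by simp
    have "y \<le> v + s" using eq by simp
    then have "y # w \<in> conts v s c z (Suc m) \<longleftrightarrow> 0 < c \<and> w \<in> conts v (s + 1) (c - 1) z m"
      unfolding conts_def mem_Collect_eq b mult zeros length_Cons nat.inject using nonzeros by blast
    then show ?thesis using eq by auto
  next
    case gr
    have c: "(\<forall>x. x \<noteq> 0 \<longrightarrow> count_list (y # w) x \<le> (if x = v then c else 2)) \<longleftrightarrow>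
      (\<forall>x. x \<noteq> 0 \<longrightarrow> count_list w x \<le> (if x = y then 1 else 2))"
      if *: "\<forall>x\<in>set w. x \<noteq> 0 \<longrightarrow> y \<le> x"
    proof -
      have v: "count_list w v = 0" if "v \<noteq> 0" using * gr that by (auto simp: count_list_0_iff)
      have "count_list (y # w) x \<le> (if x = v then c else 2) \<longleftrightarrow>
          count_list w x \<le> (if x = y then 1 else 2)" if "x \<noteq> 0" for x
        using v gr that by (cases "x = v"; cases "x = y") auto
      then show ?thesis by blast
    qed
    have "y # w \<in> conts v s c z (Suc m) \<longleftrightarrow> y \<le> v + s \<and> w \<in> conts y (v + s + 1 - y) 1 z m"
    proof (cases "y \<le> v + s")
      case True
      then have bound: "i + v + (s + 1) = i + y + (v + s + 1 - y)" for i by simp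
      have sorted: "sorted (filter (\<lambda>x. x \<noteq> 0) (y # w)) \<and> (\<forall>x\<in>set (y # w). x \<noteq> 0 \<longrightarrow> v \<le> x) \<longleftrightarrow>
          sorted (filter (\<lambda>x. x \<noteq> 0) w) \<and> (\<forall>x\<in>set w. x \<noteq> 0 \<longrightarrow> y \<le> x)" (is "?l \<longleftrightarrow> ?r")
      proof
        assume ?l
        then show ?r using gr by simp
      next
        assume ?r
        moreover from this have "v \<le> x" if "x \<in> set w" "x \<noteq> 0" for x
          using gr that by (meson le_trans less_imp_le)
        ultimately show ?l using gr by simp
      qed
      have zeros: "count_list (y # w) 0 = count_list w 0" using gr by simp
      have "y # w \<in> conts v s c z (Suc m) \<longleftrightarrow> length w = m \<and>
          (sorted (filter (\<lambda>x. x \<noteq> 0) (y # w)) \<and> (\<forall>x\<in>set (y # w). x \<noteq> 0 \<longrightarrow> v \<le> x)) \<and>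
          (\<forall>x. x \<noteq> 0 \<longrightarrow> count_list (y # w) x \<le> (if x = v then c else 2)) \<and>
          count_list w 0 \<le> z \<and> (\<forall>i<m. w ! i \<le> i + v + (s + 1))"
        unfolding conts_def mem_Collect_eq b zeros using True by (simp only: length_Cons) blast
      also have "\<dots> \<longleftrightarrow> w \<in> conts y (v + s + 1 - y) 1 z m"
        unfolding conts_def mem_Collect_eq sorted bound using c by blast
      finally show ?thesis using True by simp
    next
      case False
      then have "y # w \<notin> conts v s c z (Suc m)" unfolding conts_def mem_Collect_eq b by blast
      then show ?thesis using False by simp
    qed
    then show ?thesis using gr by auto
  qed
qed

text \<open>The number of continuations depends on \<open>v\<close> only through the slack \<open>s\<close>.  In the sum, \<open>k\<close> is the slack
  left after a new maximum \<open>v + s + 1 - k\<close>.\<close>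

fun cont_count :: "nat \<Rightarrow> nat \<Rightarrow> nat \<Rightarrow> nat \<Rightarrow> nat" where
  "cont_count 0 s c z = 1"
| "cont_count (Suc m) s c z =
     (if 0 < z then cont_count m (s + 1) c (z - 1) else 0) +
     (if 0 < c then cont_count m (s + 1) (c - 1) z else 0) +
     (\<Sum>k=1..s. cont_count m k 1 z)"

lemma card_conts:
  assumes "0 < v \<or> c = 0"
  shows "finite (conts v s c z m) \<and> card (conts v s c z m) = cont_count m s c z"
  using assms
proof (induction m arbitrary: v s c z)
  case 0
  then show ?case by (simp add: conts_0)
next
  case (Suc m)
  define Z where "Z = (if 0 < z then (#) 0 ` conts v (s + 1) c (z - 1) m else {})"
  define V where "V = (if 0 < c then (#) v ` conts v (s + 1) (c - 1) z m else {})"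
  define G where "G y = (#) y ` conts y (v + s + 1 - y) 1 z m" for y
  have eq: "conts v s c z (Suc m) = Z \<union> V \<union> (\<Union>y\<in>{v<..v+s}. G y)"
  proof (rule set_eqI)
    fix e
    show "e \<in> conts v s c z (Suc m) \<longleftrightarrow> e \<in> Z \<union> V \<union> (\<Union>y\<in>{v<..v+s}. G y)"
    proof (cases e)
      case Nil
      then show ?thesis by (auto simp: conts_def Z_def V_def G_def)
    next
      case (Cons y w)
      show ?thesis unfolding Cons Cons_mem_conts_iff[OF Suc.prems]
        by (auto simp: Z_def V_def G_def)
    qed
  qed
  have Z: "finite Z" "card Z = (if 0 < z then cont_count m (s + 1) c (z - 1) else 0)"
    using Suc.IH[of v c "s+1" "z-1"] Suc.prems by (auto simp: Z_def card_image)
  have V: "finite V" "card V = (if 0 < c then cont_count m (s + 1) (c - 1) z else 0)"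
    using Suc.IH[of v "c-1" "s+1" z] Suc.prems by (auto simp: V_def card_image)
  have G: "finite (G y)" "card (G y) = cont_count m (v + s + 1 - y) 1 z" if "v < y" for y
    using Suc.IH[of y 1 "v+s+1-y" z] that by (auto simp: G_def card_image)
  have "card (\<Union>y\<in>{v<..v+s}. G y) = (\<Sum>y\<in>{v<..v+s}. card (G y))"
    by (rule card_UN_disjoint) (use G in \<open>auto simp: G_def\<close>)
  also have "\<dots> = (\<Sum>y\<in>{v<..v+s}. cont_count m (v + s + 1 - y) 1 z)"
    by (rule sum.cong) (use G in auto)
  also have "\<dots> = (\<Sum>k=1..s. cont_count m k 1 z)"
    by (rule sum.reindex_bij_witness[of _ "\<lambda>k. v + s + 1 - k" "\<lambda>y. v + s + 1 - y"]) auto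
  finally have U: "card (\<Union>y\<in>{v<..v+s}. G y) = (\<Sum>k=1..s. cont_count m k 1 z)" .
  have fU: "finite (\<Union>y\<in>{v<..v+s}. G y)" using G by auto
  have ZV: "Z \<inter> V = {}" using Suc.prems by (auto simp: Z_def V_def)
  have ZVU: "(Z \<union> V) \<inter> (\<Union>y\<in>{v<..v+s}. G y) = {}" by (auto simp: Z_def V_def G_def)
  show ?case
    unfolding eq using Z V U fU ZV ZVU by (simp add: card_Un_disjoint)
qed

lemma card_inv_seqs_avoiding:
  "card (inv_seqs_avoiding n {[0,0,0], [0,2,1]}) = cont_count n 1 0 1"
  unfolding inv_seqs_avoiding_eq_conts using card_conts[of 0 0 1 1 n] by (simp add: card_image)

section \<open>Motzkin and central trinomial generating functions\<close>

text \<open>The square root in the closed form, that is, the square root of \<open>1 - 2x - 3x\<^sup>2\<close> with constant term 1.\<close>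

definition root_fps :: "real fps" where
  "root_fps = fps_sqrt ((1 + fps_X) * (1 - 3 * fps_X))"

lemma root_fps_nth_0: "root_fps $ 0 = 1"
  by (simp add: root_fps_def fps_sqrt_def)

lemma root_fps_sq: "root_fps ^ 2 = 1 - 2 * fps_X - 3 * fps_X ^ 2"
proof -
  let ?f = "(1 + fps_X) * (1 - 3 * fps_X) :: real fps"
  have "(root (Suc 1) (?f $ 0)) ^ Suc 1 = ?f $ 0" by simp
  then have "fps_radical root (Suc 1) ?f ^ Suc 1 = ?f"
    by (subst power_radical[symmetric]) simp_all
  then have "root_fps ^ 2 = ?f"
    unfolding root_fps_def fps_sqrt_def by (simp add: numeral_2_eq_2)
  then show ?thesis by (simp add: algebra_simps power2_eq_square)
qed

lemma root_fps_nth_1: "root_fps $ 1 = -1"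
proof -
  have "(root_fps ^ 2) $ 1 = 2 * root_fps $ 1"
    by (simp add: power2_eq_square fps_mult_nth root_fps_nth_0)
  moreover have "(root_fps ^ 2) $ 1 = -2"
    unfolding root_fps_sq by (simp add: numeral_fps_const)
  ultimately show ?thesis by simp
qed

text \<open>The generating function \<open>M = (1 - x - \<surd>(1 - 2x - 3x\<^sup>2)) / (2x\<^sup>2)\<close> of the Motzkin numbers.  The shift by two
  places is the division by \<open>x\<^sup>2\<close>; it loses nothing because the numerator has no terms of lower degree.\<close>

definition motzkin_fps :: "real fps" where
  "motzkin_fps = fps_shift 2 (fps_const (1/2) * (1 - fps_X - root_fps))"

lemma motzkin_fps_root: "2 * fps_X ^ 2 * motzkin_fps = 1 - fps_X - root_fps"
proof -
  define N where "N = fps_const (1/2) * (1 - fps_X - root_fps)"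
  have "N $ i = 0" if "i < 2" for i
    using that root_fps_nth_0 root_fps_nth_1 by (auto simp: N_def less_Suc_eq numeral_2_eq_2)
  then have "fps_X ^ 2 * fps_shift 2 N = N"
    by (intro fps_ext) (auto simp: fps_X_power_mult_nth not_less simp flip: numeral_2_eq_2 dest!: le_Suc_ex)
  then have "2 * fps_X ^ 2 * motzkin_fps = fps_const 2 * N"
    by (simp add: motzkin_fps_def N_def mult.assoc numeral_fps_const)
  also have "\<dots> = 1 - fps_X - root_fps"
    by (simp add: N_def mult.assoc[symmetric])
  finally show ?thesis .
qed

lemma motzkin_fps_eq: "motzkin_fps = 1 + fps_X * motzkin_fps + fps_X ^ 2 * motzkin_fps ^ 2"
proof -
  let ?M = motzkin_fps and ?X = "fps_X :: real fps"
  have "(1 - ?X - 2 * ?X ^ 2 * ?M) ^ 2 = 1 - 2 * ?X - 3 * ?X ^ 2"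
    unfolding motzkin_fps_root using root_fps_sq by simp
  then have "4 * ?X ^ 2 * ?M = 4 * ?X ^ 2 * (1 + ?X * ?M + ?X ^ 2 * ?M ^ 2)"
    by algebra
  then show ?thesis by simp
qed

text \<open>The generating function \<open>A\<close> of the central trinomial coefficients, \<open>A = 1 / \<surd>(1 - 2x - 3x\<^sup>2)\<close>.\<close>

definition trinomial_fps :: "real fps" where
  "trinomial_fps = inverse root_fps"

lemma trinomial_fps_root: "trinomial_fps * root_fps = 1"
  unfolding trinomial_fps_def by (rule inverse_mult_eq_1) (simp add: root_fps_nth_0)

lemma trinomial_fps_motzkin: "trinomial_fps * (1 - fps_X - 2 * fps_X ^ 2 * motzkin_fps) = 1"
  using trinomial_fps_root by (simp add: motzkin_fps_root)

section \<open>Central trinomial coefficients\<close>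

lemma gbinomial_minus_half: "(-1/2 :: real) gchoose k = (-1/4) ^ k * real ((2 * k) choose k)"
proof (induction k)
  case (Suc k)
  have 1: "real (Suc k) * ((-1/2 :: real) gchoose Suc k) = (-1/2 - real k) * ((-1/2) gchoose k)"
    using gbinomial_mult_1[of "-1/2 :: real" k] by (simp add: algebra_simps)
  have a: "Suc (2*k+1) * ((2*k+1) choose k) = (2 * Suc k choose Suc k) * Suc k"
    using Suc_times_binomial_eq[of "2*k+1" k] by (simp add: algebra_simps)
  have b: "Suc (2*k) * ((2*k) choose k) = ((2*k+1) choose k) * Suc k"
    using Suc_times_binomial_eq[of "2*k" k] binomial_symmetric[of k "2*k+1"] by simp
  have "Suc k * (Suc k * ((2 * Suc k) choose Suc k)) = Suc k * (Suc (2*k+1) * ((2*k+1) choose k))"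
    unfolding a by (simp add: mult_ac)
  also have "\<dots> = 2 * Suc k * (Suc (2*k) * ((2*k) choose k))"
    unfolding b by simp
  finally have "Suc k * (Suc k * ((2 * Suc k) choose Suc k)) = Suc k * (2 * (Suc (2*k) * ((2*k) choose k)))"
    by (simp only: mult_ac)
  then have "Suc k * ((2 * Suc k) choose Suc k) = 2 * (Suc (2*k) * ((2*k) choose k))"
    by (simp only: mult_cancel1) simp
  then have "real (Suc k * ((2 * Suc k) choose Suc k)) = real (2 * (Suc (2*k) * ((2*k) choose k)))"
    by (rule arg_cong)
  then have 2: "real (Suc k) * real ((2 * Suc k) choose Suc k) = 2 * (2 * real k + 1) * real ((2*k) choose k)"
    by (simp only: of_nat_mult of_nat_Suc) (simp add: algebra_simps)
  define C where "C = real ((2 * Suc k) choose Suc k)"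
  define D where "D = real ((2 * k) choose k)"
  have "real (Suc k) * ((-1/2 :: real) gchoose Suc k) = -1/4 * (-1/4) ^ k * (2 * (2 * real k + 1) * D)"
    unfolding 1 Suc.IH D_def by (simp add: field_simps)
  also have "\<dots> = real (Suc k) * ((-1/4) ^ Suc k * C)"
    unfolding 2[folded C_def D_def, symmetric] by simp
  finally have "real (Suc k) * ((-1/2 :: real) gchoose Suc k) = real (Suc k) * ((-1/4) ^ Suc k * C)" .
  then have "(-1/2 :: real) gchoose Suc k = (-1/4) ^ Suc k * C"
    by (simp only: mult_cancel_left) simp
  then show ?case by (simp only: C_def)
qed simp

lemma fps_mult_compose_nth:
  fixes f g h :: "'a::idom fps"
  assumes "g $ 0 = 0"
  shows "(h * (f oo g)) $ n = (\<Sum>i=0..n. f $ i * (h * g ^ i) $ n)"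
proof -
  have "(f oo g) $ (n - j) = (\<Sum>i=0..n. f $ i * (g ^ i) $ (n - j))" for j
    unfolding fps_compose_nth
    by (rule sum.mono_neutral_left) (auto simp: startsby_zero_power_prefix[OF assms])
  then have "(h * (f oo g)) $ n = (\<Sum>j=0..n. \<Sum>i=0..n. f $ i * (h $ j * (g ^ i) $ (n - j)))"
    by (simp add: fps_mult_nth sum_distrib_left mult_ac)
  also have "\<dots> = (\<Sum>i=0..n. \<Sum>j=0..n. f $ i * (h $ j * (g ^ i) $ (n - j)))"
    by (rule sum.swap)
  finally show ?thesis by (simp add: fps_mult_nth sum_distrib_left)
qed

text \<open>The binomial sum defining \<open>a_seq\<close> is read off from
  \<open>A = 1 / (1 + x) * (1 - 4x / (1 + x)) powr (-1/2)\<close>, in which the binomial series \<open>(1 + t) powr (-1/2)\<close> is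
  composed with \<open>t = -4x / (1 + x)\<close>.  The two sides agree because they have the same square and the same
  constant term.\<close>

lemma trinomial_fps_nth: "trinomial_fps $ n = real_of_int (a_seq n)"
proof -
  define h :: "real fps" where "h = inverse (1 + fps_X)"
  define g :: "real fps" where "g = fps_const (-4) * (fps_X * h)"
  define A :: "real fps" where "A = h * (fps_binomial (-1/2) oo g)"
  have h: "h * (1 + fps_X) = 1" unfolding h_def by (rule inverse_mult_eq_1) simp
  have g0: "g $ 0 = 0" by (simp add: g_def)
  have h_pow: "h ^ Suc i = fps_binomial (- real (Suc i))" for i
    by (subst fps_binomial_minus_of_nat) (simp only: h_def fps_inverse_power)
  have nth: "A $ n = real_of_int (a_seq n)" for n
  proof -
    have "fps_binomial (-1/2) $ i * (h * g ^ i) $ n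
        = (-1) ^ (n - i) * real (n choose i) * real ((2 * i) choose i)" if "i \<le> n" for i
    proof -
      have "h * g ^ i = fps_const ((-4) ^ i) * (fps_X ^ i * h ^ Suc i)"
        by (simp add: g_def power_mult_distrib fps_const_power mult_ac)
      then have "(h * g ^ i) $ n = (-4) ^ i * ((- real (Suc i)) gchoose (n - i))"
        unfolding h_pow using that by (simp add: fps_X_power_mult_nth)
      also have "(- real (Suc i)) gchoose (n - i) = (-1) ^ (n - i) * (real n gchoose (n - i))"
        using that by (subst gbinomial_minus) (simp add: of_nat_diff)
      also have "real n gchoose (n - i) = real (n choose i)"
        using that by (simp add: binomial_gbinomial[symmetric] binomial_symmetric[symmetric])
      finally show ?thesis
        by (simp add: gbinomial_minus_half[unfolded minus_divide_left[symmetric]] mult_ac flip: power_mult_distrib)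
    qed
    then show ?thesis
      unfolding A_def fps_mult_compose_nth[OF g0] a_seq_def by simp
  qed
  \<comment> \<open>It remains to show that \<open>A\<^sup>2 (1 - 2x - 3x\<^sup>2) = 1\<close>.\<close>
  have "(fps_binomial (-1/2) oo g) ^ 2 = inverse (1 + fps_X) oo g"
    by (simp add: fps_compose_power[OF g0] fps_binomial_power fps_binomial_minus_one)
  moreover have "(inverse (1 + fps_X) oo g) * (1 + g) = 1"
  proof -
    have "(inverse (1 + fps_X) oo g) * ((1 + fps_X) oo g) = (inverse (1 + fps_X) * (1 + fps_X)) oo g"
      by (rule fps_compose_mult_distrib[OF g0, symmetric])
    also have "inverse (1 + fps_X) * (1 + fps_X) = (1 :: real fps)"
      by (rule inverse_mult_eq_1) simp
    finally show ?thesis using g0 by (simp add: fps_compose_add_distrib)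
  qed
  ultimately have "A ^ 2 * (1 + g) = h ^ 2"
    by (simp add: A_def power_mult_distrib mult.assoc)
  moreover have "(1 + g) * (1 + fps_X) = 1 - 3 * fps_X"
  proof -
    have "fps_const (-4) = (- 4 :: real fps)" by (simp add: numeral_fps_const)
    then have g: "g = - 4 * (fps_X * h)" by (simp only: g_def)
    show ?thesis unfolding g using h by algebra
  qed
  ultimately have "A ^ 2 * root_fps ^ 2 = 1"
    unfolding root_fps_sq using h by algebra
  then have "A ^ 2 = trinomial_fps ^ 2"
    using trinomial_fps_root by algebra
  moreover have "A $ 0 = 1" by (simp add: nth a_seq_def)
  moreover have "trinomial_fps $ 0 = 1" by (simp add: trinomial_fps_def root_fps_nth_0)
  ultimately have "A = trinomial_fps" by (intro fps_power_eqD[of A 2]) auto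
  then show ?thesis using nth by simp
qed

section \<open>Solving the recursion\<close>

text \<open>The generating function of the continuations with slack \<open>s\<close> that have at most one zero and use no further
  copy of the current maximum.  The term without a zero is \<open>M^s\<close>; inserting a zero gives
  \<open>x (1 + s (A - 1)) M^(s+1)\<close>.\<close>

definition one_zero_fps :: "nat \<Rightarrow> real fps" where
  "one_zero_fps s = motzkin_fps ^ s
     + fps_X * (1 + of_nat s * (trinomial_fps - 1)) * motzkin_fps ^ (s + 1)"

text \<open>The generating function of \<open>cont_count m s c z\<close> in \<open>m\<close>, for \<open>c\<close> and \<open>z\<close> at most 1.  When a further copy of
  the maximum is available, the additional words use it: if there is a zero as well, then it comes either after
  that copy, or before it (the last term) with a zero-free word to follow.  The case of an unused zero is
  included in the first alternative.\<close>

definition cont_fps :: "nat \<Rightarrow> nat \<Rightarrow> nat \<Rightarrow> real fps" where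
  "cont_fps s c z =
    (if z = 0 then motzkin_fps ^ s + (if c = 0 then 0 else fps_X * motzkin_fps ^ (s + 1))
     else one_zero_fps s
       + (if c = 0 then 0 else fps_X * one_zero_fps (s + 1) + fps_X ^ 2 * motzkin_fps ^ (s + 2)))"

lemma motzkin_fps_power_eq_sum: "motzkin_fps ^ s = 1 + fps_X * (\<Sum>k=1..s. cont_fps k 1 0)"
proof (induction s)
  case (Suc s)
  have "motzkin_fps ^ Suc s = motzkin_fps ^ s * (1 + fps_X * motzkin_fps + fps_X ^ 2 * motzkin_fps ^ 2)"
    unfolding motzkin_fps_eq[symmetric] by (rule power_Suc2)
  also have "\<dots> = motzkin_fps ^ s + fps_X * cont_fps (Suc s) 1 0"
    by (simp add: cont_fps_def algebra_simps power2_eq_square)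
  finally have "motzkin_fps ^ Suc s = motzkin_fps ^ s + fps_X * cont_fps (Suc s) 1 0" .
  then show ?case unfolding Suc.IH by (simp add: algebra_simps)
qed simp

text \<open>The induction step for \<open>one_zero_fps\<close>, with \<open>m\<close> and \<open>r\<close> in the roles of \<open>M^s\<close> and \<open>s\<close>: the difference of the two
  sides is an explicit combination of the equations satisfied by \<open>M\<close> and \<open>A\<close>.\<close>

lemma motzkin_trinomial_identity:
  fixes x M A m r :: "'a::comm_ring_1"
  assumes M: "M = 1 + x * M + x ^ 2 * M ^ 2" and A: "A * (1 - x - 2 * x ^ 2 * M) = 1"
  shows "M * m + x * (1 + (1 + r) * (A - 1)) * (M * (M * m)) + x * (M * m)
      = m + x * (1 + r * (A - 1)) * (M * m) + x * (M * (M * m) +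
         (M * m + x * (1 + (1 + r) * (A - 1)) * (M * (M * m))
          + x * (M * (M * m) + x * (1 + (1 + (1 + r)) * (A - 1)) * (M * (M * (M * m))))
          + x ^ 2 * (M * (M * (M * m)))))" (is "?l = ?r")
proof -
  have "?l - ?r = m * ((M - (1 + x * M + x ^ 2 * M ^ 2)) * (1 + x * M * (1 + r * (A - 1)) - x * M)
      + x * M ^ 2 * (A * (1 - x - 2 * x ^ 2 * M) - 1))"
    by (simp add: algebra_simps power2_eq_square)
  also have "\<dots> = 0" unfolding A M[symmetric] by simp
  finally show ?thesis by simp
qed

lemma one_zero_fps_eq_sum:
  "one_zero_fps s = 1 + fps_X * (motzkin_fps ^ (s + 1) + (\<Sum>k=1..s. cont_fps k 1 1))"
proof (induction s)
  case 0
  then show ?case by (simp add: one_zero_fps_def)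
next
  case (Suc s)
  define M where "M = motzkin_fps"
  define m where "m = M ^ s"
  define A where "A = trinomial_fps"
  define r :: "real fps" where "r = of_nat s"
  have M: "M = 1 + fps_X * M + fps_X ^ 2 * M ^ 2"
    unfolding M_def by (rule motzkin_fps_eq)
  have A: "A * (1 - fps_X - 2 * fps_X ^ 2 * M) = 1"
    unfolding M_def A_def by (rule trinomial_fps_motzkin)
  have pow: "motzkin_fps ^ (s + 1) = M * m" "motzkin_fps ^ (s + 2) = M * (M * m)"
    by (simp_all add: M_def m_def)
  have E0: "one_zero_fps s = m + fps_X * (1 + r * (A - 1)) * (M * m)"
    by (simp add: one_zero_fps_def M_def m_def A_def r_def)
  have E1: "one_zero_fps (Suc s) = M * m + fps_X * (1 + (1 + r) * (A - 1)) * (M * (M * m))"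
    by (simp add: one_zero_fps_def M_def m_def A_def r_def)
  have E2: "cont_fps (Suc s) 1 1 = M * m + fps_X * (1 + (1 + r) * (A - 1)) * (M * (M * m))
          + fps_X * (M * (M * m) + fps_X * (1 + (1 + (1 + r)) * (A - 1)) * (M * (M * (M * m))))
          + fps_X ^ 2 * (M * (M * (M * m)))"
    by (simp add: cont_fps_def one_zero_fps_def M_def m_def A_def r_def)
  have "one_zero_fps (Suc s) + fps_X * motzkin_fps ^ (s + 1)
      = one_zero_fps s + fps_X * (motzkin_fps ^ (s + 2) + cont_fps (Suc s) 1 1)"
    unfolding pow E0 E1 E2 by (rule motzkin_trinomial_identity[OF M A])
  then show ?case unfolding Suc.IH by (simp add: algebra_simps)
qed

lemma cont_fps_rec:
  assumes "c \<le> 1" "z \<le> 1"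
  shows "cont_fps s c z = 1 + fps_X *
    ((if 0 < z then cont_fps (s + 1) c (z - 1) else 0) +
     (if 0 < c then cont_fps (s + 1) (c - 1) z else 0) + (\<Sum>k=1..s. cont_fps k 1 z))"
proof -
  have c00: "cont_fps s 0 0 = motzkin_fps ^ s"
    and c10: "cont_fps s 1 0 = motzkin_fps ^ s + fps_X * motzkin_fps ^ (s + 1)"
    and c01: "cont_fps s 0 1 = one_zero_fps s"
    and c11: "cont_fps s 1 1 = one_zero_fps s
      + (fps_X * one_zero_fps (s + 1) + fps_X ^ 2 * motzkin_fps ^ (s + 2))" for s
    by (simp_all add: cont_fps_def)
  define S0 where "S0 = (\<Sum>k=1..s. cont_fps k 1 0)"
  define S1 where "S1 = (\<Sum>k=1..s. cont_fps k 1 1)"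
  note sum0 = motzkin_fps_power_eq_sum[of s, folded S0_def]
  note sum1 = one_zero_fps_eq_sum[of s, folded S1_def]
  consider "c = 0" "z = 0" | "c = 1" "z = 0" | "c = 0" "z = 1" | "c = 1" "z = 1"
    using assms by linarith
  then show ?thesis
  proof cases
    case 1
    have "cont_fps s 0 0 = 1 + fps_X * S0" unfolding c00 by (rule sum0)
    then show ?thesis using 1 by (simp add: S0_def)
  next
    case 2
    have "cont_fps s 1 0 = 1 + fps_X * (cont_fps (s + 1) 0 0 + S0)"
      unfolding c10 c00 sum0 by (simp add: distrib_left)
    then show ?thesis using 2 by (simp add: S0_def)
  next
    case 3
    have "cont_fps s 0 1 = 1 + fps_X * (cont_fps (s + 1) 0 0 + S1)"
      unfolding c01 c00 by (rule sum1)
    then show ?thesis using 3 by (simp add: S1_def)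
  next
    case 4
    have "cont_fps s 1 1 = 1 + fps_X * (cont_fps (s + 1) 1 0 + cont_fps (s + 1) 0 1 + S1)"
      unfolding c11 c10 c01 sum1 by (simp add: algebra_simps power2_eq_square)
    then show ?thesis using 4 by (simp add: S1_def)
  qed
qed

text \<open>The equations of \<open>cont_fps_rec\<close> determine the coefficients recursively, in the same way as \<open>cont_count\<close> is
  defined.\<close>

lemma cont_count_eq_nth:
  assumes "c \<le> 1" "z \<le> 1"
  shows "real (cont_count m s c z) = cont_fps s c z $ m"
  using assms
proof (induction m arbitrary: s c z)
  case 0
  show ?case by (subst cont_fps_rec[OF 0]) (simp)
next
  case (Suc m)
  show ?case
    by (subst cont_fps_rec[OF Suc.prems])
      (use Suc.prems in \<open>simp add: Suc.IH fps_sum_nth\<close>)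
qed

section \<open>The generating function and its coefficients\<close>

lemma R_000_021_eq: "R_000_021 = fps_X * cont_fps 1 0 1"
  unfolding R_000_021_def card_inv_seqs_avoiding
  by (intro arg_cong[of _ _ "(*) fps_X"] fps_ext) (simp add: cont_count_eq_nth)

lemma R_000_021_closed_form:
  "2 * fps_X ^ 2 * R_000_021 =
     (3 * fps_X ^ 3 + fps_X ^ 2 - 3 * fps_X + 1) * trinomial_fps - (1 - fps_X) ^ 2"
proof -
  define M where "M = motzkin_fps"
  define A where "A = trinomial_fps"
  have "M = 1 + fps_X * M + fps_X ^ 2 * M ^ 2" "A * (1 - fps_X - 2 * fps_X ^ 2 * M) = 1"
    using motzkin_fps_eq trinomial_fps_motzkin by (simp_all add: M_def A_def)
  then have "2 * fps_X ^ 2 * (fps_X * (M + fps_X * A * M ^ 2)) =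
     (3 * fps_X ^ 3 + fps_X ^ 2 - 3 * fps_X + 1) * A - (1 - fps_X) ^ 2"
    by algebra
  moreover have "cont_fps 1 0 1 = M + fps_X * A * M ^ 2"
    by (simp add: cont_fps_def one_zero_fps_def M_def A_def power2_eq_square)
  ultimately show ?thesis by (simp only: R_000_021_eq A_def)
qed

lemma card_eq_a_seq:
  assumes "1 \<le> n"
  shows "real (card (inv_seqs_avoiding (n - 1) {[0,0,0], [0,2,1]})) =
           1 / 2 * real_of_int (3 * a_seq (n - 1) + a_seq n - 3 * a_seq (n + 1) + a_seq (n + 2))"
proof -
  \<comment> \<open>Compare the coefficients of degree \<open>n + 2 \<ge> 3\<close>, where the summand \<open>(1 - x)\<^sup>2\<close> does not contribute.\<close>
  have "(2 * fps_X ^ 2 * R_000_021) $ (n + 2) = 2 * real (card (inv_seqs_avoiding (n - 1) {[0,0,0], [0,2,1]}))"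
  proof -
    have "2 * fps_X ^ 2 * R_000_021 = fps_X ^ 2 * (fps_const 2 * R_000_021)"
      by (simp add: numeral_fps_const mult_ac)
    then have "(2 * fps_X ^ 2 * R_000_021) $ (n + 2) = 2 * R_000_021 $ n"
      by (simp only: fps_X_power_mult_nth) simp
    then show ?thesis
      using assms by (simp add: R_000_021_def)
  qed
  moreover have "((3 * fps_X ^ 3 + fps_X ^ 2 - 3 * fps_X + 1) * trinomial_fps - (1 - fps_X) ^ 2) $ (n + 2)
      = real_of_int (3 * a_seq (n - 1) + a_seq n - 3 * a_seq (n + 1) + a_seq (n + 2))"
  proof -
    have "(3 * fps_X ^ 3 + fps_X ^ 2 - 3 * fps_X + 1) * trinomial_fps - (1 - fps_X) ^ 2
      = fps_X ^ 3 * (fps_const 3 * trinomial_fps) + fps_X ^ 2 * trinomial_fps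
        - fps_X ^ 1 * (fps_const 3 * trinomial_fps) + trinomial_fps
        - (1 - fps_X * fps_const 2 + fps_X ^ 2)"
      unfolding numeral_fps_const[symmetric] by (simp add: algebra_simps power2_eq_square)
    moreover have "(1 - fps_X * fps_const 2 + fps_X ^ 2 :: real fps) $ (n + 2) = 0"
      using assms by (simp add: fps_X_power_iff)
    ultimately show ?thesis
      using assms by (simp add: fps_X_power_mult_nth trinomial_fps_nth del: power_one_right fps_const_mult)
  qed
  ultimately show ?thesis by (simp only: R_000_021_closed_form)
qed

text \<open>The differential equation satisfied by \<open>A\<close> gives a three-term recurrence for its coefficients, which
  yields the values up to \<open>a_12\<close> from the first two.\<close>

lemma trinomial_fps_deriv:
  "fps_deriv trinomial_fps * (1 - 2 * fps_X - 3 * fps_X ^ 2) = trinomial_fps * (1 + 3 * fps_X)"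
proof -
  let ?A = trinomial_fps and ?S = root_fps
  have "fps_deriv (?A * ?S) = 0" "fps_deriv (?S ^ 2) = - 2 - 6 * fps_X"
    unfolding trinomial_fps_root root_fps_sq by (simp_all add: numeral_fps_const power2_eq_square)
  then have "fps_deriv ?A * ?S + ?A * fps_deriv ?S = 0" "2 * ?S * fps_deriv ?S = - 2 - 6 * fps_X"
    by (simp_all add: power2_eq_square algebra_simps)
  then have "2 * (fps_deriv ?A * ?S ^ 2) = 2 * (?A * (1 + 3 * fps_X))"
    by algebra
  then show ?thesis by (simp add: root_fps_sq)
qed

lemma a_seq_recurrence:
  "int (n + 2) * a_seq (n + 2) = int (2 * n + 3) * a_seq (n + 1) + 3 * int (n + 1) * a_seq n"
proof -
  let ?D = "fps_deriv trinomial_fps"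
  have "?D - fps_const 2 * (fps_X * ?D) - fps_const 3 * (fps_X ^ 2 * ?D)
      = trinomial_fps + fps_const 3 * (fps_X * trinomial_fps)"
    using trinomial_fps_deriv unfolding numeral_fps_const[symmetric] by (simp add: algebra_simps)
  then have "(?D - fps_const 2 * (fps_X * ?D) - fps_const 3 * (fps_X ^ 2 * ?D)) $ (n + 1)
      = (trinomial_fps + fps_const 3 * (fps_X * trinomial_fps)) $ (n + 1)"
    by (rule arg_cong)
  then have "real (n + 2) * trinomial_fps $ (n + 2)
      = real (2 * n + 3) * trinomial_fps $ (n + 1) + 3 * real (n + 1) * trinomial_fps $ n"
    by (cases n) (simp_all add: fps_X_power_mult_nth, simp_all add: algebra_simps)
  then have "real_of_int (int (n + 2) * a_seq (n + 2))
      = real_of_int (int (2 * n + 3) * a_seq (n + 1) + 3 * int (n + 1) * a_seq n)"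
    by (simp add: trinomial_fps_nth)
  then show ?thesis by (simp only: of_int_eq_iff)
qed

lemma a_seq_values:
  "a_seq 0 = 1" "a_seq 1 = 1" "a_seq 2 = 3" "a_seq 3 = 7" "a_seq 4 = 19" "a_seq 5 = 51"
  "a_seq 6 = 141" "a_seq 7 = 393" "a_seq 8 = 1107" "a_seq 9 = 3139" "a_seq 10 = 8953"
  "a_seq 11 = 25653" "a_seq 12 = 73789"
proof -
  show a0: "a_seq 0 = 1" and a1: "a_seq 1 = 1" by (simp_all add: a_seq_def)
  show a2: "a_seq 2 = 3" using a_seq_recurrence[of 0] a0 a1 by (simp add: numeral_2_eq_2)
  show a3: "a_seq 3 = 7" using a_seq_recurrence[of 1] a1 a2 by (simp add: eval_nat_numeral)
  show a4: "a_seq 4 = 19" using a_seq_recurrence[of 2] a2 a3 by simp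
  show a5: "a_seq 5 = 51" using a_seq_recurrence[of 3] a3 a4 by simp
  show a6: "a_seq 6 = 141" using a_seq_recurrence[of 4] a4 a5 by simp
  show a7: "a_seq 7 = 393" using a_seq_recurrence[of 5] a5 a6 by simp
  show a8: "a_seq 8 = 1107" using a_seq_recurrence[of 6] a6 a7 by simp
  show a9: "a_seq 9 = 3139" using a_seq_recurrence[of 7] a7 a8 by simp
  show a10: "a_seq 10 = 8953" using a_seq_recurrence[of 8] a8 a9 by simp
  show a11: "a_seq 11 = 25653" using a_seq_recurrence[of 9] a9 a10 by simp
  show a12: "a_seq 12 = 73789" using a_seq_recurrence[of 10] a10 a11 by simp
qed

lemma R_000_021_cutoff: "fps_cutoff 11 R_000_021 =
           fps_X + 2 * fps_X ^ 2 + 5 * fps_X ^ 3 + 14 * fps_X ^ 4 + 39 * fps_X ^ 5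
           + 111 * fps_X ^ 6 + 317 * fps_X ^ 7 + 911 * fps_X ^ 8 + 2627 * fps_X ^ 9
           + 7600 * fps_X ^ 10" (is "_ = ?P")
proof (rule fps_ext)
  fix n :: nat
  have R: "R_000_021 $ n = (if n = 0 then 0 else
      1 / 2 * real_of_int (3 * a_seq (n - 1) + a_seq n - 3 * a_seq (n + 1) + a_seq (n + 2)))" for n
    using card_eq_a_seq[of n] by (simp add: R_000_021_def)
  consider "n < 11" | "11 \<le> n" by linarith
  then show "fps_cutoff 11 R_000_021 $ n = ?P $ n"
  proof cases
    case 1
    then have "n \<in> {0,1,2,3,4,5,6,7,8,9,10}"
      unfolding insert_iff empty_iff by presburger
    then show ?thesis
      by (elim insertE emptyE)
        (simp_all add: R a_seq_values a_seq_values(2)[unfolded One_nat_def] a_seq_values(3)[unfolded numeral_2_eq_2]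
          a_seq_values(4)[unfolded numeral_3_eq_3]
          numeral_fps_const fps_X_power_nth)
  next
    case 2
    then show ?thesis by (simp add: numeral_fps_const fps_X_power_nth)
  qed
qed

lemma R_000_021_laurent: "fps_to_fls R_000_021 =
           (3 * fls_X ^ 3 + fls_X ^ 2 - 3 * fls_X + 1) /
             (2 * fls_X ^ 2 * fps_to_fls (fps_sqrt ((1 + fps_X) * (1 - 3 * fps_X))))
           - (1 - fls_X) ^ 2 / (2 * fls_X ^ 2)"
proof -
  define S where "S = fps_to_fls root_fps"
  define A where "A = fps_to_fls trinomial_fps"
  have AS: "A * S = 1"
    using arg_cong[OF trinomial_fps_root, of fps_to_fls] by (simp add: A_def S_def fls_times_fps_to_fls)
  then have S0: "S \<noteq> 0" by auto
  have "2 * fls_X ^ 2 * fps_to_fls R_000_021 =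
     (3 * fls_X ^ 3 + fls_X ^ 2 - 3 * fls_X + 1) * A - (1 - fls_X) ^ 2"
    using arg_cong[OF R_000_021_closed_form, of fps_to_fls]
    by (simp add: A_def fls_times_fps_to_fls fps_to_fls_power)
  moreover have "A = 1 / S" using AS S0 by (simp add: field_simps)
  ultimately have "2 * fls_X ^ 2 * fps_to_fls R_000_021 =
     (3 * fls_X ^ 3 + fls_X ^ 2 - 3 * fls_X + 1) / S - (1 - fls_X) ^ 2" by simp
  moreover have "2 * fls_X ^ 2 \<noteq> (0 :: real fls)" by simp
  ultimately have "fps_to_fls R_000_021 =
     ((3 * fls_X ^ 3 + fls_X ^ 2 - 3 * fls_X + 1) / S - (1 - fls_X) ^ 2) / (2 * fls_X ^ 2)"
    by (metis nonzero_mult_div_cancel_left)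
  then show ?thesis
    unfolding S_def root_fps_def by (simp add: diff_divide_distrib mult.commute)
qed

theorem theorem4p1:
  shows "fps_to_fls R_000_021 =
           (3 * fls_X ^ 3 + fls_X ^ 2 - 3 * fls_X + 1) /
             (2 * fls_X ^ 2 * fps_to_fls (fps_sqrt ((1 + fps_X) * (1 - 3 * fps_X))))
           - (1 - fls_X) ^ 2 / (2 * fls_X ^ 2) \<and>
         fps_cutoff 11 R_000_021 =
           fps_X + 2 * fps_X ^ 2 + 5 * fps_X ^ 3 + 14 * fps_X ^ 4 + 39 * fps_X ^ 5
           + 111 * fps_X ^ 6 + 317 * fps_X ^ 7 + 911 * fps_X ^ 8 + 2627 * fps_X ^ 9
           + 7600 * fps_X ^ 10 \<and>
         (\<forall>n\<ge>1. real (card (inv_seqs_avoiding (n - 1) {[0,0,0], [0,2,1]})) =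
           1 / 2 * real_of_int (3 * a_seq (n - 1) + a_seq n - 3 * a_seq (n + 1) + a_seq (n + 2)))"
  using R_000_021_laurent R_000_021_cutoff card_eq_a_seq by blast

end
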